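(* Let $\tilde f\in\mathbb V_{\mathrm{ext}}^*$ be a split dual vector and let $u=\mathcal G_{\mathrm{sh}}u_{\mathrm{act}}$, with $u_{\mathrm{act}}\in\mathbb V_{DG}$, be a consistent primal vector. Then the blockwise Euclidean pairing over all cells, active and shadow, equals the active-mesh pairing of the assembled functional: $$\langle\tilde f,u\rangle=\langle\tilde f,\mathcal G_{\mathrm{sh}}u_{\mathrm{act}}\rangle=\langle\mathcal G_{\mathrm{sh}}^T\tilde f,u_{\mathrm{act}}\rangle .$$
   Context: Setting. Let $d\in\{2,3\}$, let $p$ be the polynomial degree, and let $\mathcal T_{\mathrm{act}}$ be a 2:1 balanced active mesh of axis-aligned Cartesian cells obtained by hierarchical refinement (bisection of cells into $2^d$ congruent children; adjacent active cells differ by at most one level). Every active cell having a face on the coarse side of a refinement edge (i.e. a face across which it abuts finer active cells) is a shadow parent: its $2^d$ children are added to storage as auxiliary cells called shadow cells. For an active cell $K$, $\mathrm{ch}(K)$ denotes the set of its $2^d$ shadow children if $K$ is a shadow parent, and $\mathrm{ch}(K)=\emptyset$ otherwise. Spaces. $\mathbb V_{DG}$ is the broken space of tensor-product polynomials of degree $p$ on the active mesh, identified with its coefficient vectors: one block $u|_K\in\mathbb R^{(p+1)^d}$ for each active cell $K$. The extended space $\mathbb V_{\mathrm{ext}}$ has one block in $\mathbb R^{(p+1)^d}$ per active cell and one per shadow cell. Elements of the dual spaces $\mathbb V_{DG}^*$ and $\mathbb V_{\mathrm{ext}}^*$ are represented by blocks of the same sizes, and $\langle\cdot,\cdot\rangle$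 is the blockwise Euclidean pairing: the sum over all cells (active cells for $\mathbb V_{DG}$; active and shadow cells for $\mathbb V_{\mathrm{ext}}$) of the Euclidean inner products of the blocks. Elements of $\mathbb V_{\mathrm{ext}}^*$ are called split dual vectors (their shadow blocks hold contributions belonging to the parent's test functions). Prolongation matrices. For a shadow child $K_c$ of $K$, $b=b(c)\in\{0,1\}^d$ is its position within the parent, and $\bigotimes_{i=1}^d\mathcal P_{b_i}$ is the tensor product of the $(p+1)\times(p+1)$ one-dimensional prolongation matrices $\mathcal P_0,\mathcal P_1$, which express a polynomial of degree at most $p$ on $[0,1]$ in the (rescaled) basis on the left and right half interval, respectively; it maps the coefficients of a polynomial on $K$ to the coefficients of its restriction to $K_c$. Shadow embedding. $\mathcal G_{\mathrm{sh}}:\mathbb V_{DG}\to\mathbb V_{\mathrm{ext}}$ is defined by $$(\mathcal G_{\mathrm{sh}}u)|_K=u|_K\ \ (K\text{ active}),\qquad (\mathcal G_{\mathrm{sh}}u)|_{K_c}=\Bigl(\bigotimes_{i=1}^d\mathcal P_{b_i}\Bigr)u|_K\ \ (K_c\text{ shadow child of }K).$$ A vector in $\mathbb V_{\mathrm{ext}}$ is called consistent (primal) if it lies in the image of $\mathcal G_{\mathrm{sh}}$. Shadow assembly. $\mathcal G_{\mathrm{sh}}^T:\mathbb V_{\mathrm{ext}}^*\to\mathbb V_{DG}^*$, the transpose of the embedding, is given by $$(\mathcal G_{\mathrm{sh}}^T\tilde f)|_K=\tilde f|_K+\sum_{K_c\in\mathrm{ch}(K)}\Bigl(\bigotimes_{i=1}^d\mathcal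 P_{b_i}^T\Bigr)\tilde f|_{K_c}\qquad (K\text{ active}),$$ the sum being empty on cells without shadows. The vector $\mathcal G_{\mathrm{sh}}^T\tilde f$ is called the assembled functional. *)

theory Defs
  imports "HOL-Analysis.Analysis" "HOL-Computational_Algebra.Polynomial"
begin

section \<open>Hierarchically refined Cartesian meshes\<close>

text \<open>
  A cell is given by its refinement history: \<open>Root a h\<close> is the box with lower corner \<open>a\<close> and
  edge lengths \<open>h\<close>; \<open>Child K b\<close> is the one of the \<open>2^d\<close> congruent children of \<open>K\<close> whose position
  is \<open>b \<in> {0,1}^d\<close>, with \<open>b $ i = False\<close> for the lower and \<open>True\<close> for the upper half in direction \<open>i\<close>.
\<close>

datatype 'd cell =
    Root "real ^ 'd" "real ^ 'd"
  | Child (parent: "'d cell") (position: "bool ^ 'd")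

primrec level :: "('d::finite) cell \<Rightarrow> nat" where
  "level (Root a h) = 0"
| "level (Child K b) = Suc (level K)"

primrec edge_lengths :: "('d::finite) cell \<Rightarrow> real ^ 'd" where
  "edge_lengths (Root a h) = h"
| "edge_lengths (Child K b) = (1 / 2) *\<^sub>R edge_lengths K"

primrec lower_corner :: "('d::finite) cell \<Rightarrow> real ^ 'd" where
  "lower_corner (Root a h) = a"
| "lower_corner (Child K b) =
     (\<chi> i. lower_corner K $ i + of_bool (b $ i) * (edge_lengths K $ i / 2))"

definition cell_box :: "('d::finite) cell \<Rightarrow> (real ^ 'd) set" where
  "cell_box K = cbox (lower_corner K) (lower_corner K + edge_lengths K)"

definition children :: "('d::finite) cell \<Rightarrow> 'd cell set" where
  "children K = range (Child K)"

text \<open>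
  The initial mesh is finite and conforming. As the boxes have nonempty interior, the face condition
  also makes their interiors pairwise disjoint.
\<close>

definition coarse_mesh :: "('d::finite) cell set \<Rightarrow> bool" where
  "coarse_mesh M \<longleftrightarrow>
     finite M \<and>
     (\<forall>K\<in>M. \<exists>a h. K = Root a h \<and> (\<forall>i. h $ i > 0)) \<and>
     (\<forall>K\<in>M. \<forall>L\<in>M. cell_box K \<inter> cell_box L face_of cell_box K)"

inductive_set refinements :: "('d::finite) cell set \<Rightarrow> 'd cell set set" for M :: "'d cell set" where
  initial: "M \<in> refinements M"
| refine: "T \<in> refinements M \<Longrightarrow> K \<in> T \<Longrightarrow> (T - {K}) \<union> children K \<in> refinements M"

text \<open>
  \<open>abuts_across F K L\<close>: \<open>L\<close> is a face neighbour of \<open>K\<close>, lying on the other side of the face \<open>F\<close> of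
  \<open>K\<close>, for cells \<open>K\<close> and \<open>L\<close> of one mesh. The shared part of \<open>F\<close> may be a proper subset of \<open>F\<close>.
\<close>

definition abuts_across :: "(real ^ 'd) set \<Rightarrow> ('d::finite) cell \<Rightarrow> 'd cell \<Rightarrow> bool" where
  "abuts_across F K L \<longleftrightarrow>
     K \<noteq> L \<and> F facet_of cell_box K \<and> aff_dim (F \<inter> cell_box L) = int CARD('d) - 1"

definition balanced :: "('d::finite) cell set \<Rightarrow> bool" where
  "balanced T \<longleftrightarrow>
     (\<forall>K\<in>T. \<forall>L\<in>T. (\<exists>F. abuts_across F K L) \<longrightarrow>
        level K \<le> level L + 1 \<and> level L \<le> level K + 1)"

definition shadow_parents :: "('d::finite) cell set \<Rightarrow> 'd cell set" where
  "shadow_parents T = {K \<in> T. \<exists>F. \<exists>L\<in>T. abuts_across F K L \<and> level K < level L}"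

definition shadow_children :: "('d::finite) cell set \<Rightarrow> 'd cell \<Rightarrow> 'd cell set" where
  "shadow_children T K = (if K \<in> shadow_parents T then children K else {})"

definition shadow_cells :: "('d::finite) cell set \<Rightarrow> 'd cell set" where
  "shadow_cells T = (\<Union>K\<in>T. shadow_children T K)"

definition all_cells :: "('d::finite) cell set \<Rightarrow> 'd cell set" where
  "all_cells T = T \<union> shadow_cells T"


section \<open>Coefficient blocks and spaces\<close>

text \<open>
  One-dimensional basis functions are indexed by a type \<open>'k\<close> with \<open>p + 1\<close> elements, so that
  multi-indices form the type \<open>'k ^ 'd\<close> with \<open>(p + 1)^d\<close> elements. All meshwise coefficient vectors
  are extensional functions on the set of cells that carry a block. Dual vectors are represented by
  blocks of the same sizes, so the dual spaces have the same carriers.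
\<close>

type_synonym ('k, 'd) block = "real ^ ('k ^ 'd)"

definition DG_space :: "('d::finite) cell set \<Rightarrow> ('d cell \<Rightarrow> ('k::finite, 'd) block) set" where
  "DG_space T = T \<rightarrow>\<^sub>E UNIV"

definition ext_space :: "('d::finite) cell set \<Rightarrow> ('d cell \<Rightarrow> ('k::finite, 'd) block) set" where
  "ext_space T = all_cells T \<rightarrow>\<^sub>E UNIV"

abbreviation (input) DG_dual :: "('d::finite) cell set \<Rightarrow> ('d cell \<Rightarrow> ('k::finite, 'd) block) set" where
  "DG_dual \<equiv> DG_space"

abbreviation (input) ext_dual :: "('d::finite) cell set \<Rightarrow> ('d cell \<Rightarrow> ('k::finite, 'd) block) set" where
  "ext_dual \<equiv> ext_space"

definition pairing ::
  "('d::finite) cell set \<Rightarrow> ('d cell \<Rightarrow> ('k::finite, 'd) block) \<Rightarrow> ('d cell \<Rightarrow> ('k, 'd) block) \<Rightarrow> real"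
  where "pairing S f u = (\<Sum>K\<in>S. f K \<bullet> u K)"


section \<open>Prolongation\<close>

global_interpretation polys: vector_space "smult :: real \<Rightarrow> real poly \<Rightarrow> real poly"
  by unfold_locales (simp_all add: smult_add_left smult_add_right)

definition poly_basis :: "nat \<Rightarrow> ('k::finite \<Rightarrow> real poly) \<Rightarrow> bool" where
  "poly_basis p \<phi> \<longleftrightarrow>
     inj \<phi> \<and> polys.independent (range \<phi>) \<and> polys.span (range \<phi>) = {q. degree q \<le> p}"

text \<open>
  The half interval \<open>[b/2, (b+1)/2]\<close> is the image of \<open>[0,1]\<close> under \<open>y \<mapsto> (b + y) / 2\<close>; column \<open>j\<close>
  holds the coefficients of \<open>\<phi> j\<close> pulled back along this map, i.e. those of the restriction of \<open>\<phi> j\<close>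
  with respect to the rescaled basis.
\<close>

definition prolong1 :: "('k::finite \<Rightarrow> real poly) \<Rightarrow> bool \<Rightarrow> real ^ 'k ^ 'k" where
  "prolong1 \<phi> b =
     (\<chi> i j. polys.representation (range \<phi>) (pcompose (\<phi> j) [:of_bool b / 2, 1 / 2:]) (\<phi> i))"

definition tensor :: "('d::finite \<Rightarrow> real ^ 'k ^ 'k) \<Rightarrow> real ^ ('k::finite ^ 'd) ^ ('k ^ 'd)" where
  "tensor A = (\<chi> \<alpha> \<beta>. \<Prod>i\<in>UNIV. A i $ (\<alpha> $ i) $ (\<beta> $ i))"


section \<open>Shadow embedding and shadow assembly\<close>

definition shadow_embedding ::
  "('k::finite \<Rightarrow> real poly) \<Rightarrow> ('d::finite) cell set \<Rightarrow>
     ('d cell \<Rightarrow> ('k, 'd) block) \<Rightarrow> 'd cell \<Rightarrow> ('k, 'd) block"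
  where
  "shadow_embedding \<phi> T u =
     (\<lambda>C\<in>all_cells T.
        if C \<in> T then u C
        else tensor (\<lambda>i. prolong1 \<phi> (position C $ i)) *v u (parent C))"

definition shadow_assembly ::
  "('k::finite \<Rightarrow> real poly) \<Rightarrow> ('d::finite) cell set \<Rightarrow>
     ('d cell \<Rightarrow> ('k, 'd) block) \<Rightarrow> 'd cell \<Rightarrow> ('k, 'd) block"
  where
  "shadow_assembly \<phi> T f =
     (\<lambda>K\<in>T. f K +
        (\<Sum>C\<in>shadow_children T K.
           tensor (\<lambda>i. transpose (prolong1 \<phi> (position C $ i))) *v f C))"

lemma shadow_embedding_in_ext_space: "shadow_embedding \<phi> T u \<in> ext_space T"
  by (simp add: shadow_embedding_def ext_space_def)

lemma shadow_assembly_in_DG_dual: "shadow_assembly \<phi> T f \<in> DG_dual T"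
  by (simp add: shadow_assembly_def DG_space_def)


section \<open>The prolongation matrices represent restriction to a child\<close>

text \<open>The polynomial with coefficient block \<open>c\<close>, in the unit coordinates of its cell.\<close>

definition block_poly :: "('k::finite \<Rightarrow> real poly) \<Rightarrow> ('k, 'd::finite) block \<Rightarrow> real ^ 'd \<Rightarrow> real" where
  "block_poly \<phi> c x = (\<Sum>\<alpha>\<in>UNIV. c $ \<alpha> * (\<Prod>i\<in>UNIV. poly (\<phi> (\<alpha> $ i)) (x $ i)))"

lemma sum_prolong1:
  assumes "poly_basis p \<phi>"
  shows "(\<Sum>k\<in>UNIV. prolong1 \<phi> b $ k $ j * poly (\<phi> k) y) = poly (\<phi> j) ((of_bool b + y) / 2)"
proof -
  let ?q = "pcompose (\<phi> j) [:of_bool b / 2, 1 / 2:]"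
  have inj: "inj \<phi>" and ind: "polys.independent (range \<phi>)"
    and sp: "polys.span (range \<phi>) = {q. degree q \<le> p}"
    using assms by (auto simp: poly_basis_def)
  have "\<phi> j \<in> polys.span (range \<phi>)" by (simp add: polys.span_base)
  then have "?q \<in> polys.span (range \<phi>)" by (simp add: sp degree_pcompose)
  then have "(\<Sum>v\<in>range \<phi>. smult (polys.representation (range \<phi>) ?q v) v) = ?q"
    by (intro polys.sum_representation_eq ind) auto
  then have "(\<Sum>k\<in>UNIV. smult (polys.representation (range \<phi>) ?q (\<phi> k)) (\<phi> k)) = ?q"
    by (simp add: sum.reindex[OF inj] o_def)
  then have "poly (\<Sum>k\<in>UNIV. smult (polys.representation (range \<phi>) ?q (\<phi> k)) (\<phi> k)) y = poly ?q y"
    by simp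
  then show ?thesis
    by (simp add: poly_sum prolong1_def poly_pcompose add_divide_distrib)
qed

lemma sum_prod_multi_index:
  fixes g :: "'d::finite \<Rightarrow> 'k::finite \<Rightarrow> real"
  shows "(\<Sum>\<alpha>\<in>(UNIV :: ('k ^ 'd) set). \<Prod>i\<in>UNIV. g i (\<alpha> $ i)) = (\<Prod>i\<in>UNIV. \<Sum>k\<in>UNIV. g i k)"
proof -
  have "(\<Prod>i\<in>UNIV. \<Sum>k\<in>UNIV. g i k) = (\<Sum>h\<in>UNIV. \<Prod>i\<in>UNIV. g i (h i))"
    by (subst prod_sum_PiE) simp_all
  also have "\<dots> = (\<Sum>\<alpha>\<in>(UNIV :: ('k ^ 'd) set). \<Prod>i\<in>UNIV. g i (\<alpha> $ i))"
    by (rule sum.reindex_bij_witness[of _ vec_nth vec_lambda]) auto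
  finally show ?thesis by simp
qed

lemma block_poly_prolong:
  assumes "poly_basis p \<phi>"
  shows "block_poly \<phi> (tensor (\<lambda>i. prolong1 \<phi> (b $ i)) *v c) y =
         block_poly \<phi> c (\<chi> i. (of_bool (b $ i) + y $ i) / 2)"
proof -
  let ?P = "\<lambda>i. prolong1 \<phi> (b $ i)"
  have "block_poly \<phi> (tensor ?P *v c) y =
      (\<Sum>\<alpha>\<in>UNIV. \<Sum>\<beta>\<in>UNIV. c $ \<beta> * (\<Prod>i\<in>UNIV. ?P i $ (\<alpha> $ i) $ (\<beta> $ i) * poly (\<phi> (\<alpha> $ i)) (y $ i)))"
    by (simp add: block_poly_def tensor_def matrix_vector_mult_def sum_distrib_right
        sum_distrib_left prod.distrib mult_ac)
  also have "\<dots> = (\<Sum>\<beta>\<in>UNIV. c $ \<beta> *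
      (\<Sum>\<alpha>\<in>UNIV. \<Prod>i\<in>UNIV. ?P i $ (\<alpha> $ i) $ (\<beta> $ i) * poly (\<phi> (\<alpha> $ i)) (y $ i)))"
    by (subst sum.swap) (simp add: sum_distrib_left)
  also have "\<dots> = (\<Sum>\<beta>\<in>UNIV. c $ \<beta> *
      (\<Prod>i\<in>UNIV. \<Sum>k\<in>UNIV. ?P i $ k $ (\<beta> $ i) * poly (\<phi> k) (y $ i)))"
    by (subst sum_prod_multi_index) simp
  also have "\<dots> = block_poly \<phi> c (\<chi> i. (of_bool (b $ i) + y $ i) / 2)"
    by (simp add: sum_prolong1[OF assms] block_poly_def)
  finally show ?thesis .
qed

end

theory Submission
  imports Defs
begin

text \<open>
  Blockwise, the identity is the adjointness \<open>f \<bullet> (P *v u) = (P\<^sup>T *v f) \<bullet> u\<close> with \<open>P\<close> the tensor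
  product of the one-dimensional prolongation matrices: the pairing over all cells is the pairing
  over the active cells plus, for each active \<open>K\<close>, the pairings over its shadow children, and moving
  every \<open>P\<close> to the left turns the latter into the terms that assembly adds to \<open>f K\<close>
  (lemma \<open>inner_tensor_mult\<close>).

  Regrouping the sum over all cells by parents is legitimate only if every cell is counted once and,
  in particular, no shadow cell is itself active: on an active cell the embedding copies the block
  instead of prolongating that of the parent, and the pairing counts the cell once although it is
  also a shadow. What rules this out is that a cell is removed from the mesh when it is refined, so
  that an active cell never has an active ancestor. This is an invariant of refinement, lemma
  \<open>no_active_ancestor\<close>.
\<close>

section \<open>Active cells have no active ancestors\<close>

primrec ancestors :: "('d::finite) cell \<Rightarrow> 'd cell set" where
  "ancestors (Root a h) = {}"
| "ancestors (Child K b) = insert K (ancestors K)"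

lemma level_ancestor: "A \<in> ancestors C \<Longrightarrow> level A < level C"
  by (induction C) auto

lemma parent_of_ancestor: "Child K b \<in> ancestors C \<Longrightarrow> K \<in> ancestors C"
  by (induction C) auto

lemma finite_children: "finite (children K)"
  by (simp add: children_def)

lemma finite_refinement:
  assumes "coarse_mesh M" and "T \<in> refinements M"
  shows "finite T"
  using assms(2)
proof induction
  case initial
  then show ?case using assms(1) by (simp add: coarse_mesh_def)
next
  case (refine T K)
  then show ?case by (simp add: finite_children)
qed

text \<open>
  Mere absence of an active parent is not preserved by refinement: when \<open>K\<close> is replaced by its
  children, one needs to know that none of the remaining active cells lies strictly below a child of
  \<open>K\<close>, and such a cell may be any number of generations below \<open>K\<close>. Hence the induction is on all ancestors.
\<close>

lemma no_active_ancestor: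
  assumes "coarse_mesh M" and "T \<in> refinements M"
  shows "\<forall>C\<in>T. ancestors C \<inter> T = {}"
  using assms(2)
proof induction
  case initial
  then show ?case using assms(1) by (fastforce simp: coarse_mesh_def)
next
  case (refine T K)
  show ?case
  proof
    fix C
    assume "C \<in> T - {K} \<union> children K"
    then consider "C \<in> T" | b where "C = Child K b"
      by (auto simp: children_def)
    then show "ancestors C \<inter> (T - {K} \<union> children K) = {}"
    proof cases
      case 1
      then have "K \<notin> ancestors C" using refine by blast
      then have "ancestors C \<inter> children K = {}"
        by (auto simp: children_def dest: parent_of_ancestor)
      then show ?thesis using refine.IH 1 by blast
    next
      case 2
      have "A \<notin> children K" if "A \<in> ancestors C" for A
        using level_ancestor[OF that] 2 by (auto simp: children_def)
      moreover have "ancestors K \<inter> T = {}" using refine by blast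
      ultimately show ?thesis using 2 by auto
    qed
  qed
qed

lemma children_inactive:
  assumes "coarse_mesh M" and "T \<in> refinements M" and "K \<in> T"
  shows "children K \<inter> T = {}"
  using no_active_ancestor[OF assms(1,2)] assms(3) by (fastforce simp: children_def)

section \<open>Adjointness of prolongation\<close>

lemma tensor_transpose: "tensor (\<lambda>i. transpose (A i)) = transpose (tensor A)"
  by (simp add: tensor_def transpose_def vec_eq_iff)

lemma inner_tensor_mult:
  fixes A :: "'d::finite \<Rightarrow> real ^ 'k::finite ^ 'k"
  shows "x \<bullet> (tensor A *v y) = (tensor (\<lambda>i. transpose (A i)) *v x) \<bullet> y"
  by (simp add: tensor_transpose dot_lmul_matrix)

section \<open>The pairing identity\<close>

text \<open>
  No cell is counted twice: a shadow cell determines its parent, so the sets of shadow children are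
  pairwise disjoint, and \<open>inactive\<close> separates them from the active cells.
\<close>

lemma sum_all_cells:
  fixes g :: "('d::finite) cell \<Rightarrow> real"
  assumes fin: "finite T" and inactive: "\<And>K. K \<in> T \<Longrightarrow> children K \<inter> T = {}"
  shows "sum g (all_cells T) = (\<Sum>K\<in>T. g K + sum g (shadow_children T K))"
proof -
  have fin_children: "finite (shadow_children T K)" for K
    by (simp add: shadow_children_def finite_children)
  have "T \<inter> shadow_cells T = {}"
    using inactive by (fastforce simp: shadow_cells_def shadow_children_def split: if_splits)
  moreover have "finite (shadow_cells T)"
    using fin fin_children by (simp add: shadow_cells_def)
  ultimately have "sum g (all_cells T) = sum g T + sum g (shadow_cells T)"
    unfolding all_cells_def using fin by (intro sum.union_disjoint)
  also have "sum g (shadow_cells T) = (\<Sum>K\<in>T. sum g (shadow_children T K))"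
    unfolding shadow_cells_def using fin fin_children
    by (intro sum.UNION_disjoint) (auto simp: shadow_children_def children_def)
  finally show ?thesis by (simp add: sum.distrib)
qed

lemma pairing_shadow_embedding:
  fixes f v :: "('d::finite) cell \<Rightarrow> ('k::finite, 'd) block"
  assumes "finite T" and inactive: "\<And>K. K \<in> T \<Longrightarrow> children K \<inter> T = {}"
  shows "pairing (all_cells T) f (shadow_embedding \<phi> T v) = pairing T (shadow_assembly \<phi> T f) v"
proof -
  let ?E = "shadow_embedding \<phi> T v"
  let ?P = "\<lambda>C i. prolong1 \<phi> (position C $ i)"
  have shadow: "f C \<bullet> ?E C = (tensor (\<lambda>i. transpose (?P C i)) *v f C) \<bullet> v K"
    if "K \<in> T" and C: "C \<in> shadow_children T K" for K C
  proof -
    have "C \<in> children K" using C by (auto simp: shadow_children_def split: if_splits)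
    then have "C \<notin> T" and "parent C = K"
      using inactive[OF \<open>K \<in> T\<close>] by (auto simp: children_def)
    moreover have "C \<in> all_cells T"
      using that by (auto simp: all_cells_def shadow_cells_def)
    ultimately have "?E C = tensor (?P C) *v v K"
      by (simp add: shadow_embedding_def)
    then show ?thesis by (simp add: inner_tensor_mult)
  qed
  have "pairing (all_cells T) f ?E =
      (\<Sum>K\<in>T. f K \<bullet> ?E K + (\<Sum>C\<in>shadow_children T K. f C \<bullet> ?E C))"
    unfolding pairing_def by (rule sum_all_cells[OF assms])
  also have "\<dots> = (\<Sum>K\<in>T. shadow_assembly \<phi> T f K \<bullet> v K)"
  proof (rule sum.cong[OF refl])
    fix K
    assume "K \<in> T"
    then have "?E K = v K" by (simp add: shadow_embedding_def all_cells_def)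
    then show "f K \<bullet> ?E K + (\<Sum>C\<in>shadow_children T K. f C \<bullet> ?E C) = shadow_assembly \<phi> T f K \<bullet> v K"
      using \<open>K \<in> T\<close> by (simp add: shadow shadow_assembly_def inner_add_left inner_sum_left)
  qed
  finally show ?thesis by (simp add: pairing_def)
qed

theorem lemma1:
  fixes p :: nat
    and \<phi> :: "'k::finite \<Rightarrow> real poly"
    and M T :: "('d::finite) cell set"
    and f u u_act :: "'d cell \<Rightarrow> ('k, 'd) block"
  assumes "CARD('d) \<in> {2, 3}"
    and "CARD('k) = p + 1"
    and "poly_basis p \<phi>"
    and "coarse_mesh M"
    and "T \<in> refinements M"
    and "balanced T"
    and "f \<in> ext_dual T"
    and "u_act \<in> DG_space T"
    and "u = shadow_embedding \<phi> T u_act"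
  shows "pairing (all_cells T) f u = pairing (all_cells T) f (shadow_embedding \<phi> T u_act) \<and>
         pairing (all_cells T) f (shadow_embedding \<phi> T u_act) = pairing T (shadow_assembly \<phi> T f) u_act"
proof -
  have "finite T" and "\<And>K. K \<in> T \<Longrightarrow> children K \<inter> T = {}"
    using finite_refinement children_inactive assms(4,5) by blast+
  then show ?thesis
    using assms(9) by (simp add: pairing_shadow_embedding)
qed

end
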